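(* Suppose there exists a non-trivial group $G$ operating on $\mathcal{A}$, whose operation can be extended so that for all $U,V\in\mathcal{A}$ and $g\in G$, $$g.(U\cup V)=g.U\cup g.V,\qquad g.(U\setminus V)=g.U\setminus g.V,$$ and a non-constant function $\mu:G\to(0,\infty)$ such that $m(g.U)=\mu(g)\,m(U)$ for all $U\in\mathcal{A}$, $g\in G$. Moreover, assume $\mu$ is surjective onto $(0,\infty)$. Let $H\in(0,1)$ and let $X=\{X_U;\,U\in\mathcal{A}\}$ be a square-integrable set-indexed process satisfying: 1. (self-similarity of index $H$ with respect to $G$) for all $g\in G$, the processes $\{X_{g.U};\,U\in\mathcal{A}\}$ and $\{\mu(g)^HX_U;\,U\in\mathcal{A}\}$ have the same law; 2. ($\mathcal{C}_0$-increment stationarity) for all $C,C'\in\mathcal{C}_0$ with $m(C)=m(C')$, $\Delta X_C$ and $\Delta X_{C'}$ have the same law. Then there is a constant $K$ such that for all $U,V\in\mathcal{A}$ with $U\subseteq V$, $$E[X_UX_V]=K\left[m(U)^{2H}+m(V)^{2H}-m(V\setminus U)^{2H}\right].$$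
   Context: $\mathcal{T}$ is a locally compact complete separable metric space with a Borel measure $m$. $\overline{(\cdot)}$ and $(\cdot)^\circ$ denote closure and interior. For a class $\mathcal{D}$ of sets, $\mathcal{D}(u)$ is the class of finite unions of members of $\mathcal{D}$. $\mathcal{A}$ is an indexing collection, i.e. a nonempty class of compact connected subsets of $\mathcal{T}$ such that: (1) $\emptyset\in\mathcal{A}$; $A^\circ\ne A$ if $A\in\mathcal{A}$, $A\notin\{\emptyset,\mathcal{T}\}$; there is an increasing sequence $(B_n)$ in $\mathcal{A}(u)$ with $\mathcal{T}=\bigcup_n B_n^\circ$. (2) $\mathcal{A}$ is closed under arbitrary intersections, and if $A,B\in\mathcal{A}$ are nonempty then $A\cap B\neq\emptyset$; if $(A_i)$ is an increasing sequence in $\mathcal{A}$ and there is $n$ with $A_i\subseteq B_n$ for all $i$, then $\overline{\bigcup_iA_i}\in\mathcal{A}$. (3) $\sigma(\mathcal{A})$ is the Borel $\sigma$-algebra of $\mathcal{T}$. (4) There are an increasing sequence of finite subclasses $\mathcal{A}_n\subseteq\mathcal{A}$ closed under intersections with $\emptyset,B_n\in\mathcal{A}_n(u)$, and functions $g_n:\mathcal{A}\to\mathcal{A}_n(u)\cup\{\mathcal{T}\}$ such that: (a) $g_n$ preserves arbitrary intersections and finite unions (i.e. $g_n(\bigcap_{A\in\mathcal{A}'}A)=\bigcap_{A\in\mathcal{A}'}g_n(A)$ for $\mathcal{A}'\subseteq\mathcal{A}$, and $\bigcup_{i=1}^kA_i=\bigcup_{j=1}^lA'_j$ implies $\bigcup_{i=1}^kg_n(A_i)=\bigcup_{j=1}^lg_n(A'_j)$);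 (b) $A\subseteq(g_n(A))^\circ$ for $A\in\mathcal{A}$; (c) $g_n(A)\subseteq g_k(A)$ if $n\ge k$; (d) $A=\bigcap_ng_n(A)$; (e) for $A,A'\in\mathcal{A}$, $g_n(A)\cap A'\in\mathcal{A}$, and if $A'\in\mathcal{A}_n$ then $g_n(A)\cap A'\in\mathcal{A}_n$; (f) $g_n(\emptyset)=\emptyset$. (5) Every countable intersection of sets in $\mathcal{A}(u)$ is the closure of a countable union of sets in $\mathcal{A}$. It is understood that $m(U)<\infty$ for $U\in\mathcal{A}$ and that $m(U)>0$ for some $U\in\mathcal{A}$. A set-indexed process is a family $X=\{X_U;U\in\mathcal{A}\}$ of real random variables with $X_\emptyset=0$. $\mathcal{C}_0=\{U\setminus V;\,U,V\in\mathcal{A}\}$, and for $C=U\setminus V\in\mathcal{C}_0$ the increment is $\Delta X_C=X_U-X_{U\cap V}$. "Operating on $\mathcal{A}$" means $G$ acts on the set $\mathcal{A}$ (so $g.U\in\mathcal{A}$ for $U\in\mathcal{A}$); the extension of the action is to the sets obtained from $\mathcal{A}$ by finite unions and differences. Equality in law of processes means equality of finite-dimensional distributions. *)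

theory Defs
  imports "HOL-Probability.Probability" "HOL-Algebra.Group_Action" "HOL-Algebra.Elementary_Groups"
begin

definition finite_unions :: "'a set set \<Rightarrow> 'a set set" where
  "finite_unions D = {\<Union>F | F. finite F \<and> F \<noteq> {} \<and> F \<subseteq> D}"

text \<open>
  The ambient space is the whole type. Intersections and unions of subfamilies range over
  nonempty subfamilies; the whole space need not belong to the collection. Countable families
  are given as sequences, possibly with repetitions. The sequence \<open>B\<close> is shared by all the clauses
  that mention it, so it is quantified once, together with the classes \<open>An n\<close> and the maps \<open>g n\<close>,
  which are only relevant on the members of \<open>A\<close>.
\<close>

definition indexing_collection :: "'a::polish_space set set \<Rightarrow> bool" where
  "indexing_collection A \<longleftrightarrow>
     A \<noteq> {} \<and> (\<forall>U\<in>A. compact U \<and> connected U) \<and>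
     {} \<in> A \<and>
     (\<forall>U\<in>A. U \<noteq> {} \<and> U \<noteq> UNIV \<longrightarrow> interior U \<noteq> U) \<and>
     (\<forall>F. F \<noteq> {} \<and> F \<subseteq> A \<longrightarrow> \<Inter>F \<in> A) \<and>
     (\<forall>U\<in>A. \<forall>V\<in>A. U \<noteq> {} \<and> V \<noteq> {} \<longrightarrow> U \<inter> V \<noteq> {}) \<and>
     sigma_sets UNIV A = sets borel \<and>
     (\<forall>C. range C \<subseteq> finite_unions A \<longrightarrow>
        (\<exists>D. range D \<subseteq> A \<and> (\<Inter>n::nat. C n) = closure (\<Union>n::nat. D n))) \<and>
     (\<exists>(B :: nat \<Rightarrow> 'a set) (An :: nat \<Rightarrow> 'a set set) (g :: nat \<Rightarrow> 'a set \<Rightarrow> 'a set).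
        incseq B \<and> range B \<subseteq> finite_unions A \<and> (\<Union>n. interior (B n)) = UNIV \<and>
        (\<forall>C :: nat \<Rightarrow> 'a set. incseq C \<and> range C \<subseteq> A \<and> (\<exists>n. \<forall>i. C i \<subseteq> B n)
           \<longrightarrow> closure (\<Union>i. C i) \<in> A) \<and>
        incseq An \<and>
        (\<forall>n. finite (An n) \<and> An n \<subseteq> A \<and> (\<forall>U\<in>An n. \<forall>V\<in>An n. U \<inter> V \<in> An n) \<and>
             {} \<in> finite_unions (An n) \<and> B n \<in> finite_unions (An n)) \<and>
        (\<forall>n. \<forall>U\<in>A. g n U \<in> finite_unions (An n) \<union> {UNIV}) \<and>
        (\<forall>n F. F \<noteq> {} \<and> F \<subseteq> A \<longrightarrow> g n (\<Inter>F) = (\<Inter>U\<in>F. g n U)) \<and>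
        (\<forall>n F F'. finite F \<and> F \<noteq> {} \<and> F \<subseteq> A \<and> finite F' \<and> F' \<noteq> {} \<and> F' \<subseteq> A \<and> \<Union>F = \<Union>F'
           \<longrightarrow> (\<Union>U\<in>F. g n U) = (\<Union>U\<in>F'. g n U)) \<and>
        (\<forall>n. \<forall>U\<in>A. U \<subseteq> interior (g n U)) \<and>
        (\<forall>n k. \<forall>U\<in>A. k \<le> n \<longrightarrow> g n U \<subseteq> g k U) \<and>
        (\<forall>U\<in>A. U = (\<Inter>n. g n U)) \<and>
        (\<forall>n. \<forall>U\<in>A. \<forall>V\<in>A. g n U \<inter> V \<in> A \<and> (V \<in> An n \<longrightarrow> g n U \<inter> V \<in> An n)) \<and>
        (\<forall>n. g n {} = {}))"

definition set_indexed_process ::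
    "'w measure \<Rightarrow> 'a set set \<Rightarrow> ('a set \<Rightarrow> 'w \<Rightarrow> real) \<Rightarrow> bool" where
  "set_indexed_process P A X \<longleftrightarrow>
     (\<forall>U\<in>A. X U \<in> borel_measurable P) \<and> (AE w in P. X {} w = 0)"

definition square_integrable_process ::
    "'w measure \<Rightarrow> 'a set set \<Rightarrow> ('a set \<Rightarrow> 'w \<Rightarrow> real) \<Rightarrow> bool" where
  "square_integrable_process P A X \<longleftrightarrow> (\<forall>U\<in>A. integrable P (\<lambda>w. (X U w)\<^sup>2))"

text \<open>Equality of all finite-dimensional distributions of two processes indexed by \<open>I\<close>.\<close>

definition same_law ::
    "'w measure \<Rightarrow> 'i set \<Rightarrow> ('i \<Rightarrow> 'w \<Rightarrow> real) \<Rightarrow> ('i \<Rightarrow> 'w \<Rightarrow> real) \<Rightarrow> bool" where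
  "same_law P I X Y \<longleftrightarrow>
     (\<forall>J. finite J \<and> J \<subseteq> I \<longrightarrow>
        distr P (\<Pi>\<^sub>M i\<in>J. borel) (\<lambda>w. \<lambda>i\<in>J. X i w) =
        distr P (\<Pi>\<^sub>M i\<in>J. borel) (\<lambda>w. \<lambda>i\<in>J. Y i w))"

definition self_similar ::
    "'w measure \<Rightarrow> 'a set set \<Rightarrow> ('g, 'b) monoid_scheme \<Rightarrow> ('g \<Rightarrow> 'a set \<Rightarrow> 'a set) \<Rightarrow>
     ('g \<Rightarrow> real) \<Rightarrow> real \<Rightarrow> ('a set \<Rightarrow> 'w \<Rightarrow> real) \<Rightarrow> bool" where
  "self_similar P A G \<phi> \<mu> H X \<longleftrightarrow>
     (\<forall>g\<in>carrier G. same_law P A (\<lambda>U. X (\<phi> g U)) (\<lambda>U w. \<mu> g powr H * X U w))"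

text \<open>
  The increment over \<open>C = U - V\<close>, as a function of the pair \<open>(U, V)\<close> representing \<open>C\<close>.
  Stationarity is accordingly required of all representations, so no separate assumption
  that the increment depends only on \<open>U - V\<close> is needed.
\<close>

definition increment :: "('a set \<Rightarrow> 'w \<Rightarrow> real) \<Rightarrow> 'a set \<Rightarrow> 'a set \<Rightarrow> 'w \<Rightarrow> real" where
  "increment X U V = (\<lambda>w. X U w - X (U \<inter> V) w)"

definition C0_increment_stationary ::
    "'w measure \<Rightarrow> 'a measure \<Rightarrow> 'a set set \<Rightarrow> ('a set \<Rightarrow> 'w \<Rightarrow> real) \<Rightarrow> bool" where
  "C0_increment_stationary P m A X \<longleftrightarrow>
     (\<forall>U\<in>A. \<forall>V\<in>A. \<forall>U'\<in>A. \<forall>V'\<in>A. measure m (U - V) = measure m (U' - V') \<longrightarrow>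
        distr P borel (increment X U V) = distr P borel (increment X U' V'))"

text \<open>
  An extension of an action on \<open>A\<close> to the sets obtained from \<open>A\<close> by finite unions and
  differences, i.e. to the ring of sets generated by \<open>A\<close>, compatible with the union and the
  difference of members of \<open>A\<close>.
\<close>

definition set_operation_extension ::
    "('g, 'b) monoid_scheme \<Rightarrow> 'a set set \<Rightarrow> ('g \<Rightarrow> 'a set \<Rightarrow> 'a set) \<Rightarrow>
     ('g \<Rightarrow> 'a set \<Rightarrow> 'a set) \<Rightarrow> bool" where
  "set_operation_extension G A \<phi> \<psi> \<longleftrightarrow>
     group_action G (ring_of_sets UNIV hull A) \<psi> \<and>
     (\<forall>g\<in>carrier G. \<forall>U\<in>A. \<psi> g U = \<phi> g U) \<and>
     (\<forall>g\<in>carrier G. \<forall>U\<in>A. \<forall>V\<in>A.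
        \<psi> g (U \<union> V) = \<psi> g U \<union> \<psi> g V \<and> \<psi> g (U - V) = \<psi> g U - \<psi> g V)"

end

theory Submission
  imports Defs
begin

text \<open>
  Polarization reduces the covariance to second moments: if \<open>U \<subseteq> V\<close>, then
  \<open>2 X\<^sub>U X\<^sub>V = X\<^sub>U\<^sup>2 + X\<^sub>V\<^sup>2 - (X\<^sub>V - X\<^sub>U)\<^sup>2\<close>, and all three terms are squares of increments, since
  \<open>X\<^sub>V - X\<^sub>U\<close> is the increment over \<open>V - U\<close> and, because \<open>X\<close> vanishes on the empty set, \<open>X\<^sub>U\<close> is the
  increment over \<open>U - {}\<close>. It thus suffices that the second moment of the increment over \<open>C\<close> is a
  constant multiple of \<open>m(C)\<^sup>2\<^sup>H\<close>.

  By stationarity this second moment depends only on \<open>s = m(C)\<close>, so it can be computed on any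
  convenient set of the same measure. Fix \<open>W \<in> A\<close> of positive measure. If \<open>s > 0\<close>, surjectivity of
  \<open>\<mu>\<close> provides \<open>g\<close> with \<open>m(g.W) = \<mu>(g) m(W) = s\<close>, and self-similarity scales the second moment of
  \<open>X\<^sub>W\<close> by \<open>\<mu>(g)\<^sup>2\<^sup>H = (s / m(W))\<^sup>2\<^sup>H\<close>. If \<open>s = 0\<close>, the comparison with \<open>{} - {}\<close> shows that the
  increment is almost surely zero.
\<close>

lemma same_law_marginal:
  assumes "same_law P I X Y" and "i \<in> I"
    and [measurable]: "X i \<in> borel_measurable P" "Y i \<in> borel_measurable P"
  shows "distr P borel (X i) = distr P borel (Y i)"
proof -
  \<comment> \<open>The one-dimensional law is the image of the law indexed by \<open>{i}\<close> under evaluation at \<open>i\<close>.\<close>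
  have marginal: "distr (distr P (\<Pi>\<^sub>M j\<in>{i}. borel) (\<lambda>w. \<lambda>j\<in>{i}. Z j w)) borel (\<lambda>f. f i)
      = distr P borel (Z i)" if [measurable]: "Z i \<in> borel_measurable P" for Z :: "_ \<Rightarrow> _ \<Rightarrow> real"
  proof -
    have "(\<lambda>w. \<lambda>j\<in>{i}. Z j w) \<in> measurable P (\<Pi>\<^sub>M j\<in>{i}. borel)"
      by (rule measurable_restrict) (use that in auto)
    then show ?thesis
      by (subst distr_distr) (auto simp: comp_def)
  qed
  have "distr P (\<Pi>\<^sub>M j\<in>{i}. borel) (\<lambda>w. \<lambda>j\<in>{i}. X j w)
      = distr P (\<Pi>\<^sub>M j\<in>{i}. borel) (\<lambda>w. \<lambda>j\<in>{i}. Y j w)"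
    using assms(1,2) unfolding same_law_def by blast
  then show ?thesis
    using marginal[of X, OF assms(3)] marginal[of Y, OF assms(4)] by simp
qed

lemma second_moment_cong_distr:
  fixes Y Z :: "'w \<Rightarrow> real"
  assumes "distr P borel Y = distr P borel Z"
    and "Y \<in> borel_measurable P" "Z \<in> borel_measurable P"
  shows "(\<integral>w. (Y w)\<^sup>2 \<partial>P) = (\<integral>w. (Z w)\<^sup>2 \<partial>P)"
proof -
  have sq: "(\<lambda>x::real. x\<^sup>2) \<in> borel_measurable borel"
    by measurable
  show ?thesis
    using integral_distr[OF assms(2) sq] integral_distr[OF assms(3) sq] assms(1) by simp
qed

lemma self_similar_second_moment:
  assumes "self_similar P A G \<phi> \<mu> H X" and "set_indexed_process P A X"
    and "group_action G A \<phi>" and "g \<in> carrier G" and "U \<in> A"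
  shows "(\<integral>w. (X (\<phi> g U) w)\<^sup>2 \<partial>P) = \<mu> g powr (2 * H) * (\<integral>w. (X U w)\<^sup>2 \<partial>P)"
proof -
  have gU: "\<phi> g U \<in> A"
    by (rule group_action.element_image[OF assms(3-5) refl])
  have X: "X V \<in> borel_measurable P" if "V \<in> A" for V
    using assms(2)[unfolded set_indexed_process_def, THEN conjunct1] that by (rule bspec)
  have meas: "X (\<phi> g U) \<in> borel_measurable P" "(\<lambda>w. \<mu> g powr H * X U w) \<in> borel_measurable P"
    by (rule X[OF gU]) (rule borel_measurable_times[OF borel_measurable_const X[OF \<open>U \<in> A\<close>]])
  have "same_law P A (\<lambda>U. X (\<phi> g U)) (\<lambda>U w. \<mu> g powr H * X U w)"
    using assms(1)[unfolded self_similar_def] assms(4) by (rule bspec)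
  from same_law_marginal[OF this \<open>U \<in> A\<close> meas]
  have "distr P borel (X (\<phi> g U)) = distr P borel (\<lambda>w. \<mu> g powr H * X U w)" .
  from second_moment_cong_distr[OF this meas]
  have "(\<integral>w. (X (\<phi> g U) w)\<^sup>2 \<partial>P) = (\<integral>w. (\<mu> g powr H)\<^sup>2 * (X U w)\<^sup>2 \<partial>P)"
    by (simp add: power_mult_distrib)
  also have "(\<mu> g powr H)\<^sup>2 = \<mu> g powr (2 * H)"
    by (simp add: power2_eq_square flip: powr_add)
  finally show ?thesis
    by simp
qed

lemma second_moment_increment_empty:
  assumes "set_indexed_process P A X" and "{} \<in> A" and "U \<in> A"
  shows "(\<integral>w. (increment X U {} w)\<^sup>2 \<partial>P) = (\<integral>w. (X U w)\<^sup>2 \<partial>P)"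
proof (rule integral_cong_AE)
  have [measurable]: "X U \<in> borel_measurable P" "X {} \<in> borel_measurable P"
    using assms unfolding set_indexed_process_def by auto
  show "(\<lambda>w. (increment X U {} w)\<^sup>2) \<in> borel_measurable P" "(\<lambda>w. (X U w)\<^sup>2) \<in> borel_measurable P"
    by (auto simp: increment_def)
  have "AE w in P. X {} w = 0"
    using assms(1) unfolding set_indexed_process_def by simp
  then show "AE w in P. (increment X U {} w)\<^sup>2 = (X U w)\<^sup>2"
    by eventually_elim (simp add: increment_def)
qed

text \<open>
  The point where stationarity and self-similarity meet: the dilates \<open>g.W\<close> of a single set realize
  every positive measure, so they calibrate the second moments of all increments.
\<close>

lemma second_moment_increment:
  assumes "set_indexed_process P A X" and "self_similar P A G \<phi> \<mu> H X"
    and "C0_increment_stationary P m A X"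
    and "group_action G A \<phi>"
    and "\<mu> ` carrier G = {0<..}"
    and "\<And>U g. U \<in> A \<Longrightarrow> g \<in> carrier G \<Longrightarrow> measure m (\<phi> g U) = \<mu> g * measure m U"
    and inter: "\<And>U V. U \<in> A \<Longrightarrow> V \<in> A \<Longrightarrow> U \<inter> V \<in> A"
    and "{} \<in> A" and W: "W \<in> A" "measure m W > 0" and UV: "U \<in> A" "V \<in> A"
  shows "(\<integral>w. (increment X U V w)\<^sup>2 \<partial>P) =
    (\<integral>w. (X W w)\<^sup>2 \<partial>P) / measure m W powr (2 * H) * measure m (U - V) powr (2 * H)"
proof -
  have meas: "increment X U' V' \<in> borel_measurable P" if "U' \<in> A" "V' \<in> A" for U' V'
    using assms(1) that inter[OF that] unfolding set_indexed_process_def increment_def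
    by (intro borel_measurable_diff) auto
  have stationary: "(\<integral>w. (increment X U V w)\<^sup>2 \<partial>P) = (\<integral>w. (increment X U' {} w)\<^sup>2 \<partial>P)"
    if "U' \<in> A" "measure m (U - V) = measure m U'" for U'
  proof (rule second_moment_cong_distr)
    have "measure m (U - V) = measure m (U' - {})"
      using that(2) by simp
    then show "distr P borel (increment X U V) = distr P borel (increment X U' {})"
      using assms(3) UV that(1) \<open>{} \<in> A\<close> unfolding C0_increment_stationary_def by blast
  qed (use meas UV that(1) \<open>{} \<in> A\<close> in auto)
  show ?thesis
  proof (cases "measure m (U - V) = 0")
    case True
    then have "(\<integral>w. (increment X U V w)\<^sup>2 \<partial>P) = (\<integral>w. (increment X {} {} w)\<^sup>2 \<partial>P)"
      by (intro stationary) (use \<open>{} \<in> A\<close> in auto)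
    then show ?thesis
      using True by (simp add: increment_def)
  next
    case False
    then have "measure m (U - V) > 0"
      by (simp add: zero_less_measure_iff)
    then have "measure m (U - V) / measure m W \<in> \<mu> ` carrier G"
      using assms(5) W(2) by simp
    then obtain g where g: "g \<in> carrier G" "\<mu> g = measure m (U - V) / measure m W"
      by force
    have gW: "\<phi> g W \<in> A"
      by (rule group_action.element_image[OF assms(4) g(1) W(1) refl])
    have "measure m (U - V) = measure m (\<phi> g W)"
      using assms(6)[OF W(1) g(1)] g(2) W(2) by simp
    then have "(\<integral>w. (increment X U V w)\<^sup>2 \<partial>P) = (\<integral>w. (X (\<phi> g W) w)\<^sup>2 \<partial>P)"
      using stationary[OF gW] second_moment_increment_empty[OF assms(1) \<open>{} \<in> A\<close> gW] by simp
    also have "\<dots> = \<mu> g powr (2 * H) * (\<integral>w. (X W w)\<^sup>2 \<partial>P)"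
      by (rule self_similar_second_moment[OF assms(2,1,4) g(1) W(1)])
    also have "\<mu> g powr (2 * H) = measure m (U - V) powr (2 * H) / measure m W powr (2 * H)"
      unfolding g(2) using W(2) by (simp add: powr_divide)
    finally show ?thesis
      by simp
  qed
qed

lemma expectation_mult_polarization:
  fixes Y Z :: "'w \<Rightarrow> real"
  assumes [measurable]: "Y \<in> borel_measurable P" "Z \<in> borel_measurable P"
    and int: "integrable P (\<lambda>w. (Y w)\<^sup>2)" "integrable P (\<lambda>w. (Z w)\<^sup>2)"
  shows "(\<integral>w. Y w * Z w \<partial>P) =
    ((\<integral>w. (Y w)\<^sup>2 \<partial>P) + (\<integral>w. (Z w)\<^sup>2 \<partial>P) - (\<integral>w. (Z w - Y w)\<^sup>2 \<partial>P)) / 2"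
proof -
  have "integrable P (\<lambda>w. (Z w - Y w)\<^sup>2)"
  proof (rule Bochner_Integration.integrable_bound)
    show "integrable P (\<lambda>w. 2 * (Y w)\<^sup>2 + 2 * (Z w)\<^sup>2)"
      using int by simp
    have "(Z w - Y w)\<^sup>2 \<le> 2 * (Y w)\<^sup>2 + 2 * (Z w)\<^sup>2" for w
      using zero_le_power2[of "Z w + Y w"] by (simp add: power2_eq_square algebra_simps)
    then show "AE w in P. norm ((Z w - Y w)\<^sup>2) \<le> norm (2 * (Y w)\<^sup>2 + 2 * (Z w)\<^sup>2)"
      by simp
  qed measurable
  then have "((\<integral>w. (Y w)\<^sup>2 \<partial>P) + (\<integral>w. (Z w)\<^sup>2 \<partial>P) - (\<integral>w. (Z w - Y w)\<^sup>2 \<partial>P)) / 2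
      = (\<integral>w. ((Y w)\<^sup>2 + (Z w)\<^sup>2 - (Z w - Y w)\<^sup>2) / 2 \<partial>P)"
    using int by simp
  also have "\<dots> = (\<integral>w. Y w * Z w \<partial>P)"
    by (intro Bochner_Integration.integral_cong) (simp_all add: power2_eq_square algebra_simps)
  finally show ?thesis
    by simp
qed

theorem proposition4p1:
  fixes m :: "'a::polish_space measure"
    and A :: "'a set set"
    and G :: "('g, 'b) monoid_scheme"
    and \<phi> :: "'g \<Rightarrow> 'a set \<Rightarrow> 'a set"
    and \<mu> :: "'g \<Rightarrow> real"
    and H :: real
    and P :: "'w measure"
    and X :: "'a set \<Rightarrow> 'w \<Rightarrow> real"
  assumes "locally compact (UNIV :: 'a set)"
    and "sets m = sets borel"
    and "indexing_collection A"
    and "\<And>U. U \<in> A \<Longrightarrow> emeasure m U < \<infinity>"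
    and "\<exists>U\<in>A. emeasure m U > 0"
    and "\<not> trivial_group G"
    and "group_action G A \<phi>"
    and "\<exists>\<psi>. set_operation_extension G A \<phi> \<psi>"
    and "\<mu> \<in> carrier G \<rightarrow> {0<..}"
    and "\<not> \<mu> constant_on carrier G"
    and "\<mu> ` carrier G = {0<..}"
    and "\<And>U g. U \<in> A \<Longrightarrow> g \<in> carrier G \<Longrightarrow> measure m (\<phi> g U) = \<mu> g * measure m U"
    and "0 < H" and "H < 1"
    and "prob_space P"
    and "set_indexed_process P A X"
    and "square_integrable_process P A X"
    and "self_similar P A G \<phi> \<mu> H X"
    and "C0_increment_stationary P m A X"
  shows "\<exists>K::real. \<forall>U\<in>A. \<forall>V\<in>A. U \<subseteq> V \<longrightarrow>
           prob_space.expectation P (\<lambda>w. X U w * X V w) =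
             K * (measure m U powr (2 * H) + measure m V powr (2 * H)
                  - measure m (V - U) powr (2 * H))"
proof -
  have empty: "{} \<in> A"
    using assms(3)[unfolded indexing_collection_def, THEN conjunct2, THEN conjunct2, THEN conjunct1] .
  have inter: "U \<inter> V \<in> A" if "U \<in> A" "V \<in> A" for U V
  proof -
    have "\<forall>F. F \<noteq> {} \<and> F \<subseteq> A \<longrightarrow> \<Inter>F \<in> A"
        using assms(3)[unfolded indexing_collection_def, THEN conjunct2, THEN conjunct2, THEN conjunct2, THEN conjunct2, THEN conjunct1] .
    from this[rule_format, of "{U, V}"] show ?thesis
      using that by simp
  qed
  obtain W where W: "W \<in> A" "emeasure m W > 0"
    using assms(5) by blast
  then have W_pos: "measure m W > 0"
    using assms(4)[OF W(1)] by (simp add: measure_def enn2real_positive_iff)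
  define c where "c = (\<integral>w. (X W w)\<^sup>2 \<partial>P) / measure m W powr (2 * H)"
  have increment: "(\<integral>w. (increment X U V w)\<^sup>2 \<partial>P) = c * measure m (U - V) powr (2 * H)"
    if "U \<in> A" "V \<in> A" for U V
    unfolding c_def
    by (rule second_moment_increment[OF assms(16,18,19,7,11,12) inter empty W(1) W_pos that])
  have moment: "(\<integral>w. (X U w)\<^sup>2 \<partial>P) = c * measure m U powr (2 * H)" if "U \<in> A" for U
    using increment[OF that empty] second_moment_increment_empty[OF assms(16) empty that] by simp
  have "(\<integral>w. X U w * X V w \<partial>P) = c / 2 * (measure m U powr (2 * H) + measure m V powr (2 * H)
      - measure m (V - U) powr (2 * H))" if UV: "U \<in> A" "V \<in> A" "U \<subseteq> V" for U V
  proof -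
    have "increment X V U = (\<lambda>w. X V w - X U w)"
      using \<open>U \<subseteq> V\<close> by (simp add: increment_def Int_absorb1)
    then have "(\<integral>w. (X V w - X U w)\<^sup>2 \<partial>P) = c * measure m (V - U) powr (2 * H)"
      using increment[OF UV(2,1)] by simp
    moreover have "(\<integral>w. X U w * X V w \<partial>P) =
        ((\<integral>w. (X U w)\<^sup>2 \<partial>P) + (\<integral>w. (X V w)\<^sup>2 \<partial>P) - (\<integral>w. (X V w - X U w)\<^sup>2 \<partial>P)) / 2"
      by (rule expectation_mult_polarization)
        (use assms(16,17) UV in \<open>auto simp: set_indexed_process_def square_integrable_process_def\<close>)
    ultimately show ?thesis
      by (simp add: moment UV field_simps)
  qed
  then show ?thesis
    by (intro exI ballI impI)
qed

end
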